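(* For every integer $k\ge 3$ and every real $\gamma>0$ there exists $\epsilon>0$ such that the following holds for all sufficiently large integers $n$. If $H$ is a $k$-graph on $n$ vertices with $\alpha(H)\le \epsilon n$ and $\delta_{k-1}(H)\ge \gamma n$, then $H$ contains a matching that covers all but at most $k$ vertices of $H$.
   Context: A $k$-graph $H=(V(H),E(H))$ has edge set $E(H)\subseteq\binom{V(H)}{k}$. A matching is a set of pairwise vertex-disjoint edges. For a $(k-1)$-set $S$ of vertices, $\deg_H(S)$ is the number of $1$-sets $T$ with $S\cup T\in E(H)$; the minimum codegree $\delta_{k-1}(H)$ is the minimum of $\deg_H(S)$ over all $(k-1)$-sets $S\subseteq V(H)$. The independence number $\alpha(H)$ is the maximum size of a vertex set containing no edge of $H$. *)

theory Defs
  imports Complex_Main "HOL-Library.Ramsey"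
begin

text \<open>A hypergraph is given by its vertex set \<open>V\<close> and its edge set \<open>E\<close>;
  \<open>nsets V k\<close> is the library's set of all \<open>k\<close>-element subsets of \<open>V\<close>.\<close>

definition kgraph :: "nat \<Rightarrow> 'a set \<Rightarrow> 'a set set \<Rightarrow> bool" where
  "kgraph k V E \<longleftrightarrow> finite V \<and> E \<subseteq> nsets V k"

definition hmatching :: "'a set set \<Rightarrow> 'a set set \<Rightarrow> bool" where
  "hmatching E M \<longleftrightarrow> M \<subseteq> E \<and> pairwise disjnt M"

definition codegree :: "'a set \<Rightarrow> 'a set set \<Rightarrow> 'a set \<Rightarrow> nat" where
  "codegree V E S = card {T \<in> nsets V 1. S \<union> T \<in> E}"

text \<open>The minimum is meaningful only if \<open>V\<close> is finite and has at least \<open>k - 1\<close> elements;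
  otherwise \<open>Min\<close> is applied to an empty or infinite set.\<close>

definition min_codegree :: "nat \<Rightarrow> 'a set \<Rightarrow> 'a set set \<Rightarrow> nat" where
  "min_codegree k V E = Min (codegree V E ` nsets V (k - 1))"

definition hindependent :: "'a set \<Rightarrow> 'a set set \<Rightarrow> 'a set \<Rightarrow> bool" where
  "hindependent V E I \<longleftrightarrow> I \<subseteq> V \<and> (\<forall>e\<in>E. \<not> e \<subseteq> I)"

definition independence_number :: "'a set \<Rightarrow> 'a set set \<Rightarrow> nat" where
  "independence_number V E = Max (card ` {I. hindependent V E I})"

end

theory Submission
  imports Defs
begin

text \<open>
  Given a set \<open>X\<close> of \<open>k + 1\<close> vertices, split it as \<open>S \<union> {x, y}\<close> with \<open>|S| = k - 1\<close> and build an edge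
  \<open>e = {a, c\<^sub>1, \<dots>, c\<^sub>k\<^sub>-\<^sub>3, b, z}\<close> by choosing \<open>a\<close> completing \<open>S\<close> to an edge, the \<open>c\<^sub>i\<close> arbitrarily, \<open>b\<close>
  completing \<open>{x, y, c\<^sub>1, \<dots>, c\<^sub>k\<^sub>-\<^sub>3}\<close>, and \<open>z\<close> completing \<open>e\<close>. A matching edge \<open>e\<close> of this kind can be
  exchanged for the two edges \<open>S \<union> {a}\<close> and \<open>{x, y, c\<^sub>1, \<dots>, c\<^sub>k\<^sub>-\<^sub>3, b}\<close>, covering \<open>k\<close> more vertices. A
  positive proportion of all \<open>k\<close>-sets are such edges, so a greedy choice gives any bounded number of
  disjoint small matchings, each containing such an \<open>e\<close> for every \<open>X\<close>. They are set aside.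

  A maximum matching of the rest misses only boundedly many vertices: otherwise a linear number of
  vertices \<open>w\<close> lie in the neighbourhoods of at least \<open>k\<close> members of a family of disjoint uncovered
  \<open>(k-1)\<close>-sets. Choosing in each matching edge through such a \<open>w\<close> a second vertex \<open>u\<close>, the small
  independence number yields an edge \<open>f\<close> consisting of \<open>k\<close> of the \<open>u\<close>'s, and the \<open>k\<close> matching edges
  involved can be replaced by \<open>f\<close> together with \<open>k\<close> edges joining the vertices \<open>w\<close> to distinct
  uncovered \<open>(k-1)\<close>-sets. The bounded leftover is then absorbed \<open>k\<close> vertices at a time, using one
  reserved matching per step.
\<close>

section \<open>Neighbourhoods, absorbing edges and elementary facts on matchings\<close>

definition nbrs :: "'a set \<Rightarrow> 'a set set \<Rightarrow> 'a set \<Rightarrow> 'a set" where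
  "nbrs V E S = {v \<in> V. insert v S \<in> E}"

text \<open>In the applications \<open>X\<close> has \<open>k + 1\<close> vertices and
  \<open>e\<close> is an edge of a reserved matching. Exactly one vertex of
  \<open>X \<union> e\<close> then stays outside \<open>f \<union> g\<close>, and trading
  \<open>e\<close> for \<open>f\<close> and \<open>g\<close> gains \<open>k\<close> covered
  vertices.\<close>

definition absorbs :: "'a set set \<Rightarrow> 'a set \<Rightarrow> 'a set \<Rightarrow> bool" where
  "absorbs E X e \<longleftrightarrow> e \<inter> X = {} \<and> (\<exists>f\<in>E. \<exists>g\<in>E. f \<inter> g = {} \<and> f \<union> g \<subseteq> X \<union> e)"

lemma codegree_eq_card_nbrs: "codegree V E S = card (nbrs V E S)"
proof -
  have "{T \<in> nsets V 1. S \<union> T \<in> E} = (\<lambda>v. {v}) ` nbrs V E S"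
    by (auto simp: nbrs_def nsets_def card_1_singleton_iff)
  then show ?thesis
    by (simp add: codegree_def card_image)
qed

lemma min_codegree_le_nbrs:
  assumes "finite V" "S \<in> nsets V (k - 1)"
  shows "min_codegree k V E \<le> card (nbrs V E S)"
  using assms by (auto simp: min_codegree_def codegree_eq_card_nbrs[symmetric] finite_imp_finite_nsets)

lemma ex_edge_of_independence_number:
  assumes "finite V" "W \<subseteq> V" "independence_number V E < card W"
  shows "\<exists>e\<in>E. e \<subseteq> W"
proof (rule ccontr)
  assume "\<not> ?thesis"
  then have "hindependent V E W" using assms by (auto simp: hindependent_def)
  moreover have "finite {I. hindependent V E I}"
    by (rule finite_subset[of _ "Pow V"]) (use assms in \<open>auto simp: hindependent_def\<close>)
  ultimately have "card W \<le> independence_number V E"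
    by (auto simp: independence_number_def)
  then show False using assms by simp
qed

lemma card_nsets_le_power:
  assumes "finite V"
  shows "card (nsets V k) \<le> card V ^ k"
proof -
  have "nsets V k = {N. N \<subseteq> V \<and> card N = k}"
    using assms by (auto simp: nsets_def intro: finite_subset)
  then have "card (nsets V k) = card V choose k" using n_subsets[OF assms] by simp
  then show ?thesis by (cases "k \<le> card V") (simp_all add: binomial_le_pow binomial_eq_0)
qed

lemma hmatching_Un:
  assumes "hmatching E M" "hmatching E N" "\<Union>M \<inter> \<Union>N = {}"
  shows "hmatching E (M \<union> N)"
proof -
  have cross: "disjnt a b" "disjnt b a" if "a \<in> M" "b \<in> N" for a b
    using assms(3) that by (auto simp: disjnt_def)
  have "pairwise disjnt (M \<union> N)"
    using assms(1,2) cross unfolding hmatching_def by (intro pairwiseI) (metis UnE pairwiseD)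
  then show ?thesis using assms(1,2) by (auto simp: hmatching_def)
qed

lemma hmatching_subset: "hmatching E M \<Longrightarrow> N \<subseteq> M \<Longrightarrow> hmatching E N"
  by (auto simp: hmatching_def intro: pairwise_subset)

lemma card_Union_hmatching:
  assumes "finite V" "E \<subseteq> nsets V k" "hmatching E M"
  shows "card (\<Union>M) = k * card M" "finite M" "\<Union>M \<subseteq> V"
proof -
  have M: "M \<subseteq> E" "pairwise disjnt M" using assms(3) by (auto simp: hmatching_def)
  have e: "finite e" "card e = k" "e \<subseteq> V" if "e \<in> M" for e
    using that M assms by (auto simp: nsets_def)
  show "\<Union>M \<subseteq> V" using e by auto
  then show "finite M" using assms(1) finite_UnionD finite_subset by blast
  have "card (\<Union>M) = sum card M"
    using M e by (intro card_Union_disjoint) auto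
  then show "card (\<Union>M) = k * card M" using e by simp
qed

section \<open>Counting absorbing edges by successive choices\<close>

text \<open>\<open>N xs\<close> holds the admissible continuations of the history \<open>xs\<close>.
  With ordered lists, different choices give different objects and lower bounds multiply; the order
  is forgotten only after counting.\<close>

primrec extensions :: "('a list \<Rightarrow> 'a set) \<Rightarrow> nat \<Rightarrow> 'a list set" where
  "extensions N 0 = {[]}"
| "extensions N (Suc n) = (\<Union>xs\<in>extensions N n. (\<lambda>v. xs @ [v]) ` N xs)"

lemma length_extensions: "xs \<in> extensions N n \<Longrightarrow> length xs = n"
  by (induction n arbitrary: xs) auto

text \<open>The bound on \<open>N\<close> is asked only for reachable prefixes, so invariants of
  these, such as distinctness, are available when it is verified.\<close>

lemma card_extensions_ge:
  fixes d :: real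
  assumes "d \<ge> 0"
    and "\<And>m xs. m < n \<Longrightarrow> xs \<in> extensions N m \<Longrightarrow> finite (N xs) \<and> d \<le> card (N xs)"
  shows "finite (extensions N n) \<and> d ^ n \<le> card (extensions N n)"
  using assms(2)
proof (induction n)
  case 0
  then show ?case by simp
next
  case (Suc n)
  have "finite (extensions N n) \<and> d ^ n \<le> card (extensions N n)"
    by (rule Suc.IH, rule Suc.prems) simp_all
  then have IH: "finite (extensions N n)" "d ^ n \<le> card (extensions N n)" by auto
  have fin: "\<And>xs. xs \<in> extensions N n \<Longrightarrow> finite (N xs) \<and> d \<le> card (N xs)"
    using Suc.prems by blast
  have "card (extensions N (Suc n)) = (\<Sum>xs\<in>extensions N n. card ((\<lambda>v. xs @ [v]) ` N xs))"
    unfolding extensions.simps using IH fin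
    by (intro card_UN_disjoint) auto
  also have "\<dots> = (\<Sum>xs\<in>extensions N n. card (N xs))"
    by (intro sum.cong refl card_image) (auto simp: inj_on_def)
  finally have "real (card (extensions N (Suc n))) = (\<Sum>xs\<in>extensions N n. real (card (N xs)))"
    by simp
  also have "\<dots> \<ge> card (extensions N n) * d"
    using fin by (intro sum_bounded_below) auto
  finally have "card (extensions N n) * d \<le> card (extensions N (Suc n))" .
  moreover have "d ^ Suc n \<le> card (extensions N n) * d"
    using IH(2) assms(1) by (simp add: mult.commute mult_left_mono)
  ultimately show ?case using IH fin by auto
qed

text \<open>Vertices are chosen in the order \<open>a\<close>, the \<open>c\<close>'s,
  \<open>b\<close>, \<open>z\<close>. Each avoids \<open>F\<close>, \<open>X\<close> and at most
  \<open>k - 1\<close> earlier vertices, so the degree hypothesis leaves at least \<open>d\<close>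
  options and there are at least \<open>d ^ k\<close> lists. At most \<open>k ^ k\<close> lists of
  length \<open>k\<close> have their entries in a given \<open>k\<close>-set, whence the division by
  \<open>k\<close>.\<close>

lemma card_absorbers_ge:
  fixes d :: real
  assumes V: "finite V" "E \<subseteq> nsets V k" and k: "k \<ge> 3" and d: "d \<ge> 0"
    and deg: "\<And>S. S \<in> nsets V (k - 1) \<Longrightarrow> d + card F + 2 * k + 1 \<le> card (nbrs V E S)"
    and X: "X \<in> nsets V (k + 1)" and F: "F \<subseteq> V"
  shows "(d / k) ^ k \<le> card {e \<in> E. e \<inter> F = {} \<and> absorbs E X e}"
proof -
  have X': "X \<subseteq> V" "finite X" "card X = k + 1" using X by (auto simp: nsets_def)
  obtain x where x: "x \<in> X" using X'(3) by fastforce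
  have "card (X - {x}) = k" using X' x by simp
  then have "X - {x} \<noteq> {}" using k by (metis card.empty not_numeral_le_zero)
  then obtain y where y: "y \<in> X - {x}" by blast
  define S where "S = X - {x, y}"
  have S: "S \<subseteq> V" "finite S" "card S = k - 1" "x \<notin> S" "y \<notin> S" "x \<noteq> y" "S \<subseteq> X"
    using X' x y by (auto simp: S_def card_Diff_subset)
  \<comment> \<open>Position \<open>0\<close> yields \<open>a\<close>, position \<open>k - 2\<close>
    yields \<open>b\<close> and position \<open>k - 1\<close> yields \<open>z\<close>;
    \<open>k \<ge> 3\<close> keeps the three apart. \<open>tl\<close> drops \<open>a\<close>, which
    belongs to the other edge.\<close>
  define base where "base xs =
    (if length xs = 0 then nbrs V E S
     else if length xs = k - 2 then nbrs V E ({x, y} \<union> set (tl xs))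
     else if length xs = k - 1 then nbrs V E (set xs) else V)" for xs
  define N where "N xs = base xs - F - X - set xs" for xs
  have N_sub: "N xs \<subseteq> V - F - X - set xs" for xs
    by (auto simp: N_def base_def nbrs_def)
  have basic: "distinct xs \<and> set xs \<subseteq> V - F - X" if "xs \<in> extensions N m" for xs m
    using that
  proof (induction m arbitrary: xs)
    case (Suc m)
    then obtain ys v where "xs = ys @ [v]" "ys \<in> extensions N m" "v \<in> N ys" by auto
    then show ?case using Suc.IH[of ys] N_sub[of ys] by auto
  qed auto
  have hd: "hd xs \<in> nbrs V E S" if "xs \<in> extensions N m" "m > 0" for xs m
    using that
  proof (induction m arbitrary: xs)
    case (Suc m)
    then obtain ys v where ys: "xs = ys @ [v]" "ys \<in> extensions N m" "v \<in> N ys" by auto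
    show ?case
    proof (cases m)
      case 0
      then show ?thesis using ys by (auto simp: N_def base_def)
    next
      case (Suc m')
      then have "ys \<noteq> []" using length_extensions[OF ys(2)] by auto
      then show ?thesis using Suc.IH[OF ys(2)] Suc ys(1) by (simp)
    qed
  qed auto
  have count: "finite (N xs) \<and> d \<le> card (N xs)" if m: "m < k" "xs \<in> extensions N m" for m xs
  proof -
    have len: "length xs = m" and xs: "distinct xs" "set xs \<subseteq> V - F - X"
      using length_extensions[OF m(2)] basic[OF m(2)] by auto
    have "card (set (tl xs)) = k - 3" if "m = k - 2"
      using xs len that by (simp add: distinct_card distinct_tl)
    moreover have "set (tl xs) \<subseteq> set xs" by (cases xs) auto
    moreover have "{x, y} \<inter> set (tl xs) = {}" using calculation(2) xs x y by auto
    ultimately have T: "{x, y} \<union> set (tl xs) \<in> nsets V (k - 1)" if "m = k - 2"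
      using that xs x y X' k S(6) by (auto simp: nsets_def card_Un_disjoint card_insert_if)
    have T': "set xs \<in> nsets V (k - 1)" if "m = k - 1"
      using that xs len by (auto simp: nsets_def distinct_card)
    have T'': "S \<in> nsets V (k - 1)" using S by (auto simp: nsets_def)
    \<comment> \<open>The free positions draw from all of \<open>V\<close>, which is at least as
      large as a neighbourhood.\<close>
    have "card (nbrs V E S) \<le> card V" by (rule card_mono) (use V in \<open>auto simp: nbrs_def\<close>)
    then have "d + card F + 2 * k + 1 \<le> card V" using deg[OF T''] by linarith
    then have base: "d + card F + 2 * k + 1 \<le> card (base xs)"
      using deg[OF T] deg[OF T'] deg[OF T''] len by (auto simp: base_def)
    have fin: "finite F" "finite (base xs)" using F V by (auto simp: base_def nbrs_def intro: finite_subset)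
    have "N xs = base xs - (F \<union> X \<union> set xs)" by (auto simp: N_def)
    then have "card (base xs) - card (F \<union> X \<union> set xs) \<le> card (N xs)"
      using diff_card_le_card_Diff[of "F \<union> X \<union> set xs" "base xs"] fin X' by simp
    moreover have "card (F \<union> X \<union> set xs) \<le> card F + (k + 1) + k"
      using card_Un_le[of "F \<union> X" "set xs"] card_Un_le[of F X] X' card_length[of xs] len m by linarith
    ultimately show ?thesis using base fin by (auto simp: N_def)
  qed
  define G where "G = {e \<in> E. e \<inter> F = {} \<and> absorbs E X e}"
  have finG: "finite G" using V by (auto simp: G_def intro: finite_subset finite_imp_finite_nsets)
  have "set xs \<in> G" if xs: "xs \<in> extensions N k" for xs
  proof -
    \<comment> \<open>The entries \<open>b\<close> and \<open>z\<close> complete one new edge and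
      \<open>set xs\<close> itself; \<open>z\<close> is the vertex that the exchange leaves
      uncovered. As \<open>k \<ge> 3\<close>, the rest \<open>ys\<close> still contains
      \<open>a\<close>.\<close>
    obtain j where j: "k = Suc (Suc j)" using k that[of "k - 2"] by simp
    then obtain ys b z where ys: "xs = ys @ [b, z]" "ys \<in> extensions N j" "b \<in> N ys" "z \<in> N (ys @ [b])"
      using xs by fastforce
    have len: "length ys = j" "j > 0" using length_extensions[OF ys(2)] k j by auto
    have inE: "set xs \<in> E" using ys(4) len j by (auto simp: ys(1) N_def base_def nbrs_def insert_commute)
    have h: "insert (hd ys) S \<in> E" using hd[OF ys(2)] len by (auto simp: nbrs_def)
    have g: "insert b ({x, y} \<union> set (tl ys)) \<in> E" using ys(3) len j by (auto simp: N_def base_def nbrs_def)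
    have dist: "distinct xs" "set xs \<subseteq> V - F - X" using basic[OF xs] by auto
    obtain a as where a: "ys = a # as" using len by (cases ys) auto
    have "insert (hd ys) S \<inter> insert b ({x, y} \<union> set (tl ys)) = {}"
      using dist S x y unfolding ys(1) a by auto
    moreover have "insert (hd ys) S \<union> insert b ({x, y} \<union> set (tl ys)) \<subseteq> X \<union> set xs"
      using S x y unfolding ys(1) a by auto
    ultimately have "absorbs E X (set xs)"
      using dist h g unfolding absorbs_def by blast
    then show ?thesis using inE dist by (auto simp: G_def)
  qed
  then have "extensions N k \<subseteq> (\<Union>e\<in>G. {xs. set xs \<subseteq> e \<and> length xs = k})"
    using length_extensions by fastforce
  moreover have fe: "finite e \<and> card e = k" if "e \<in> G" for e
    using that V by (auto simp: G_def nsets_def)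
  ultimately have "card (extensions N k) \<le> card (\<Union>e\<in>G. {xs. set xs \<subseteq> e \<and> length xs = k})"
    using finG by (intro card_mono) (auto intro!: finite_lists_length_eq)
  also have "\<dots> \<le> (\<Sum>e\<in>G. card {xs. set xs \<subseteq> e \<and> length xs = k})"
    by (rule card_UN_le[OF finG])
  also have "\<dots> = (\<Sum>e\<in>G. k ^ k)"
    using fe by (intro sum.cong refl) (simp add: card_lists_length_eq)
  finally have "card (extensions N k) \<le> card G * k ^ k" by simp
  then have "real (card (extensions N k)) \<le> card G * real k ^ k"
    by (metis of_nat_le_iff of_nat_mult of_nat_power)
  moreover have "d ^ k \<le> card (extensions N k)" using card_extensions_ge[OF d count] by auto
  ultimately have "d ^ k \<le> card G * real k ^ k" by linarith
  then show ?thesis using k by (simp add: G_def power_divide divide_le_eq)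
qed

section \<open>Greedy construction of the absorbing matchings\<close>

text \<open>Double counting of the pairs with \<open>P x e\<close>. Only an upper bound
  \<open>N\<close> on \<open>card B\<close> enters, so \<open>card V ^ k\<close> can stand in for
  the number of candidate edges.\<close>

lemma ex_popular:
  fixes c :: real
  assumes "finite A" "finite B" "card B \<le> N" "N > 0" "A \<noteq> {}" "c > 0"
    and deg: "\<And>x. x \<in> A \<Longrightarrow> c * N \<le> card {e \<in> B. P x e}"
  shows "\<exists>e\<in>B. c * card A \<le> card {x \<in> A. P x e}"
proof (rule ccontr)
  assume "\<not> ?thesis"
  then have less: "\<And>e. e \<in> B \<Longrightarrow> card {x \<in> A. P x e} < c * card A" by force
  have "c * card A > 0" using assms by (simp add: card_gt_0_iff)
  have "card A * (c * N) \<le> (\<Sum>x\<in>A. real (card {e \<in> B. P x e}))"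
    using deg by (intro sum_bounded_below)
  also have "\<dots> = real (\<Sum>x\<in>A. card {e \<in> B. P x e})" by simp
  also have "(\<Sum>x\<in>A. card {e \<in> B. P x e}) = (\<Sum>e\<in>B. card {x \<in> A. P x e})"
    using sum.swap_restrict[OF assms(1,2), of "\<lambda>_ _. 1::nat" P] by simp
  also have "real \<dots> = (\<Sum>e\<in>B. real (card {x \<in> A. P x e}))" by simp
  finally have *: "card A * (c * N) \<le> (\<Sum>e\<in>B. real (card {x \<in> A. P x e}))" .
  show False
  proof (cases "B = {}")
    case True
    obtain x where "x \<in> A" using assms by auto
    then have "c * N \<le> 0" using deg[of x] True by simp
    then show False using assms by (simp add: mult_le_0_iff)
  next
    case False
    have "(\<Sum>e\<in>B. real (card {x \<in> A. P x e})) < (\<Sum>e\<in>B. c * card A)"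
      using less False assms by (intro sum_strict_mono) auto
    also have "\<dots> \<le> N * (c * card A)" using assms by (auto intro!: mult_right_mono)
    finally show False using * by (simp add: mult_ac)
  qed
qed


text \<open>While sets of \<open>A\<close> remain unabsorbed, averaging yields a further edge that
  absorbs a fixed fraction of them. One half of the codegree pays for the vertices to avoid, the
  other half is the \<open>d\<close> of \<open>card_absorbers_ge\<close>.\<close>

lemma ex_matching_absorbing_most:
  fixes \<gamma> :: real
  assumes V: "finite V" "card V > 0" "E \<subseteq> nsets V k" and k: "k \<ge> 3" and \<gamma>: "0 < \<gamma>" "\<gamma> \<le> 1"
    and deg: "\<And>S. S \<in> nsets V (k - 1) \<Longrightarrow> \<gamma> * card V \<le> card (nbrs V E S)"
    and F: "F \<subseteq> V" and A: "A \<subseteq> nsets V (k + 1)"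
    and small: "card F + k * t + 2 * k + 1 \<le> \<gamma> / 2 * card V"
  shows "\<exists>R. hmatching E R \<and> \<Union>R \<inter> F = {} \<and> card R \<le> t \<and>
    card {X \<in> A. \<not> (\<exists>e\<in>R. absorbs E X e)} \<le> (1 - (\<gamma> / (2 * real k)) ^ k) ^ t * card A"
  using small
proof (induction t)
  case 0
  show ?case by (intro exI[of _ "{}"]) (auto simp: hmatching_def)
next
  case (Suc t)
  define \<beta> where "\<beta> = (\<gamma> / (2 * real k)) ^ k"
  have \<beta>: "0 < \<beta>" "\<beta> \<le> 1"
    using \<gamma> k by (auto simp: \<beta>_def divide_le_eq intro!: power_le_one)
  have finA: "finite A" using A V(1) finite_imp_finite_nsets finite_subset by blast
  have "card F + k * t + 2 * k + 1 \<le> \<gamma> / 2 * card V" using Suc.prems by simp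
  then obtain R where R: "hmatching E R" "\<Union>R \<inter> F = {}" "card R \<le> t"
    "card {X \<in> A. \<not> (\<exists>e\<in>R. absorbs E X e)} \<le> (1 - \<beta>) ^ t * card A"
    using Suc.IH unfolding \<beta>_def by blast
  note cR = card_Union_hmatching[OF V(1,3) R(1)]
  define B where "B = {X \<in> A. \<not> (\<exists>e\<in>R. absorbs E X e)}"
  show ?case
  proof (cases "B = {}")
    case True
    then have "card {X \<in> A. \<not> (\<exists>e\<in>R. absorbs E X e)} = 0" unfolding B_def by (metis card.empty)
    moreover have "0 \<le> (1 - \<beta>) ^ Suc t * card A" using \<beta> by simp
    ultimately show ?thesis using R by (intro exI[of _ R]) (simp add: \<beta>_def)
  next
    case False
    \<comment> \<open>Forbidding the vertices of \<open>R\<close> too keeps the new edge disjoint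
      from the matching; they number at most \<open>k * t\<close>, as budgeted in
      \<open>small\<close>.\<close>
    define F' where "F' = F \<union> \<Union>R"
    have F': "F' \<subseteq> V" using F cR by (auto simp: F'_def)
    have "card F' \<le> card F + k * t"
      using card_Un_le[of F "\<Union>R"] cR R(3) mult_le_mono2[OF R(3), of k] unfolding F'_def by linarith
    then have "card F' + 2 * k + 1 \<le> card F + k * Suc t + 2 * k + 1" by simp
    then have "real (card F' + 2 * k + 1) \<le> \<gamma> / 2 * card V"
      using Suc.prems by (meson of_nat_le_iff order_trans)
    then have d: "\<gamma> / 2 * card V + card F' + 2 * k + 1 \<le> card (nbrs V E S)" if "S \<in> nsets V (k - 1)" for S
      using deg[OF that] by (simp add: algebra_simps)
    have many: "\<beta> * (card V ^ k) \<le> card {e \<in> {e \<in> E. e \<inter> F' = {}}. absorbs E X e}" if "X \<in> B" for X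
    proof -
      have "X \<in> nsets V (k + 1)" using that A by (auto simp: B_def)
      from card_absorbers_ge[OF V(1,3) k _ d this F'] \<gamma>
      have "(\<gamma> / 2 * card V / k) ^ k \<le> card {e \<in> E. e \<inter> F' = {} \<and> absorbs E X e}" by simp
      also have "{e \<in> E. e \<inter> F' = {} \<and> absorbs E X e} = {e \<in> {e \<in> E. e \<inter> F' = {}}. absorbs E X e}" by auto
      also have "(\<gamma> / 2 * card V / k) ^ k = \<beta> * (card V ^ k)"
        unfolding \<beta>_def of_nat_power power_mult_distrib[symmetric] by (simp add: mult_ac)
      finally show ?thesis .
    qed
    have finE: "finite E" using V finite_imp_finite_nsets finite_subset by blast
    have "card {e \<in> E. e \<inter> F' = {}} \<le> card (nsets V k)"
      using V by (intro card_mono) (auto simp: finite_imp_finite_nsets)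
    also have "\<dots> \<le> card V ^ k" by (rule card_nsets_le_power[OF V(1)])
    finally have cE: "card {e \<in> E. e \<inter> F' = {}} \<le> card V ^ k" .
    obtain e where e: "e \<in> E" "e \<inter> F' = {}" "\<beta> * card B \<le> card {X \<in> B. absorbs E X e}"
      using ex_popular[of B "{e \<in> E. e \<inter> F' = {}}" "card V ^ k" \<beta> "absorbs E", OF _ _ cE _ False \<beta>(1) many] 
        finA finE V(2) by (auto simp: B_def)
    have "{X \<in> A. \<not> (\<exists>e\<in>insert e R. absorbs E X e)} = B - {X \<in> B. absorbs E X e}"
      by (auto simp: B_def)
    moreover have "finite B" using finA by (simp add: B_def)
    then have "card {X \<in> B. absorbs E X e} \<le> card B"
      and "card (B - {X \<in> B. absorbs E X e}) = card B - card {X \<in> B. absorbs E X e}"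
      by (auto intro!: card_mono card_Diff_subset)
    ultimately have "card {X \<in> A. \<not> (\<exists>e\<in>insert e R. absorbs E X e)} \<le> (1 - \<beta>) * card B"
      using e(3) by (simp add: algebra_simps of_nat_diff)
    also have "\<dots> \<le> (1 - \<beta>) * ((1 - \<beta>) ^ t * card A)"
      using R(4) \<beta> by (intro mult_left_mono) (auto simp: B_def)
    finally have "card {X \<in> A. \<not> (\<exists>e\<in>insert e R. absorbs E X e)} \<le> (1 - \<beta>) ^ Suc t * card A" by simp
    moreover have "hmatching E (insert e R)"
      using R e by (auto simp: hmatching_def pairwise_insert disjnt_def F'_def)
    moreover have "\<Union>(insert e R) \<inter> F = {}" using R e by (auto simp: F'_def)
    moreover have "card (insert e R) \<le> Suc t" using R(3) by (simp add: card_insert_if cR)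
    ultimately show ?thesis unfolding \<beta>_def by blast
  qed
qed

text \<open>The matchings are built in turn, each avoiding the earlier ones. The hypothesis on
  \<open>t\<close> pushes the number of unabsorbed sets below one, and an integer below one is
  zero.\<close>

lemma ex_absorbing_matchings:
  fixes \<gamma> :: real and k t C :: nat
  assumes V: "finite V" "card V > 0" "E \<subseteq> nsets V k" and k: "k \<ge> 3" and \<gamma>: "0 < \<gamma>" "\<gamma> \<le> 1"
    and deg: "\<And>S. S \<in> nsets V (k - 1) \<Longrightarrow> \<gamma> * card V \<le> card (nbrs V E S)"
    and small: "k * t * C + 2 * k + 1 \<le> \<gamma> / 2 * card V"
    and t: "(1 - (\<gamma> / (2 * real k)) ^ k) ^ t * card V ^ (k + 1) < 1"
  shows "\<exists>R. \<forall>i<C. hmatching E (R i) \<and> card (R i) \<le> t \<and>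
      (\<forall>X\<in>nsets V (k + 1). \<exists>e\<in>R i. absorbs E X e) \<and> (\<forall>j<i. \<Union>(R i) \<inter> \<Union>(R j) = {})"
  using small
proof (induction C)
  case 0
  show ?case by simp
next
  case (Suc C)
  define \<beta> where "\<beta> = (\<gamma> / (2 * real k)) ^ k"
  have \<beta>: "0 < \<beta>" "\<beta> \<le> 1"
    using \<gamma> k by (auto simp: \<beta>_def divide_le_eq intro!: power_le_one)
  have "real (k * t * C + 2 * k + 1) \<le> real (k * t * Suc C + 2 * k + 1)"
    by (intro of_nat_mono) simp
  then have "k * t * C + 2 * k + 1 \<le> \<gamma> / 2 * card V" using Suc.prems by linarith
  then obtain R where R: "\<forall>i<C. hmatching E (R i) \<and> card (R i) \<le> t \<and>
      (\<forall>X\<in>nsets V (k + 1). \<exists>e\<in>R i. absorbs E X e) \<and> (\<forall>j<i. \<Union>(R i) \<inter> \<Union>(R j) = {})"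
    using Suc.IH by blast
  define F where "F = (\<Union>i<C. \<Union>(R i))"
  have Fi: "card (\<Union>(R i)) \<le> k * t \<and> \<Union>(R i) \<subseteq> V" if "i < C" for i
    using card_Union_hmatching[OF V(1,3), of "R i"] R that by (auto intro: mult_le_mono2)
  have "card F \<le> (\<Sum>i<C. card (\<Union>(R i)))" unfolding F_def by (rule card_UN_le) simp
  also have "\<dots> \<le> (\<Sum>i<C. k * t)" using Fi by (intro sum_mono) auto
  finally have "card F + k * t + 2 * k + 1 \<le> k * t * Suc C + 2 * k + 1" by (simp add: algebra_simps)
  then have "card F + k * t + 2 * k + 1 \<le> \<gamma> / 2 * card V"
    using Suc.prems by linarith
  moreover have "F \<subseteq> V" using Fi by (auto simp: F_def)
  ultimately obtain Q where Q: "hmatching E Q" "\<Union>Q \<inter> F = {}" "card Q \<le> t"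
    "card {X \<in> nsets V (k + 1). \<not> (\<exists>e\<in>Q. absorbs E X e)} \<le> (1 - \<beta>) ^ t * card (nsets V (k + 1))"
    using ex_matching_absorbing_most[OF V k \<gamma> deg, of F "nsets V (k + 1)" t] unfolding \<beta>_def by blast
  have "card (nsets V (k + 1)) \<le> card V ^ (k + 1)"
    by (rule card_nsets_le_power[OF V(1)])
  then have "(1 - \<beta>) ^ t * card (nsets V (k + 1)) \<le> (1 - \<beta>) ^ t * card V ^ (k + 1)"
    using \<beta> by (intro mult_left_mono) (simp_all only: of_nat_le_iff zero_le_power diff_ge_0_iff_ge)
  then have "card {X \<in> nsets V (k + 1). \<not> (\<exists>e\<in>Q. absorbs E X e)} < 1"
    using Q(4) t unfolding \<beta>_def by linarith
  then have "{X \<in> nsets V (k + 1). \<not> (\<exists>e\<in>Q. absorbs E X e)} = {}"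
    using V(1) finite_imp_finite_nsets[OF V(1), of "k + 1"] by simp
  then have "\<forall>X\<in>nsets V (k + 1). \<exists>e\<in>Q. absorbs E X e" by blast
  moreover have "\<Union>Q \<inter> \<Union>(R j) = {}" if "j < C" for j
    using Q(2) that by (auto simp: F_def)
  ultimately show ?case
    using R Q(1,3) by (intro exI[of _ "R(C := Q)"]) (simp add: less_Suc_eq)
qed

section \<open>Absorbing the leftover\<close>

text \<open>Induction on the number of reserves, the last one being spent first. Each is either
  added to \<open>M\<close> whole or used for one exchange, which lowers the number of uncovered
  vertices by \<open>k\<close>. An exchange needs \<open>k + 1\<close> uncovered vertices, hence the
  final bound \<open>k\<close>.\<close>

lemma ex_matching_of_absorbing_matchings:
  assumes V: "finite V" "E \<subseteq> nsets V k" and k: "k > 0"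
    and R: "\<And>i. i < C \<Longrightarrow> hmatching E (R i)"
    "\<And>i X. i < C \<Longrightarrow> X \<in> nsets V (k + 1) \<Longrightarrow> \<exists>e\<in>R i. absorbs E X e"
    "\<And>i j. j < i \<Longrightarrow> i < C \<Longrightarrow> \<Union>(R i) \<inter> \<Union>(R j) = {}"
    and M: "hmatching E M" "\<And>i. i < C \<Longrightarrow> \<Union>M \<inter> \<Union>(R i) = {}"
    "card (V - \<Union>M - (\<Union>i<C. \<Union>(R i))) \<le> k + k * C"
  shows "\<exists>M'. hmatching E M' \<and> card (V - \<Union>M') \<le> k"
  using R M
proof (induction C arbitrary: M)
  case 0
  then show ?case by auto
next
  case (Suc C)
  have fresh: "\<Union>(R C) \<inter> \<Union>(R i) = {}" if "i < C" for i
    using Suc.prems(3)[of i C] that by simp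
  have RC: "hmatching E (R C)" "\<Union>M \<inter> \<Union>(R C) = {}" using Suc.prems by auto
  define U where "U = V - \<Union>M - (\<Union>i<Suc C. \<Union>(R i))"
  have finU: "finite U" using V by (simp add: U_def)
  have step: ?case if M': "hmatching E M'" "\<And>i. i < C \<Longrightarrow> \<Union>M' \<inter> \<Union>(R i) = {}"
    "card (V - \<Union>M' - (\<Union>i<C. \<Union>(R i))) \<le> k + k * C" for M'
    by (rule Suc.IH[OF Suc.prems(1-3) M']) auto
  show ?case
  proof (cases "card U \<le> k + k * C")
    case True
    \<comment> \<open>Enough is covered already: no exchange is made and \<open>R C\<close> joins
      \<open>M\<close> unchanged.\<close>
    have "V - \<Union>(M \<union> R C) - (\<Union>i<C. \<Union>(R i)) = U" by (auto simp: U_def less_Suc_eq)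
    moreover have "hmatching E (M \<union> R C)"
      by (rule hmatching_Un[OF Suc.prems(4) RC])
    ultimately show ?thesis
      using True fresh Suc.prems(5) by (intro step[of "M \<union> R C"]) (auto simp: Int_Un_distrib2)
  next
    case False
    then have "k + 1 \<le> card U" by simp
    then obtain X where X: "X \<subseteq> U" "card X = k + 1" by (meson obtain_subset_with_card_n)
    then have "X \<in> nsets V (k + 1)" using finU by (auto simp: nsets_def U_def intro: finite_subset)
    then obtain e f g where e: "e \<in> R C" "e \<inter> X = {}"
      and fg: "f \<in> E" "g \<in> E" "f \<inter> g = {}" "f \<union> g \<subseteq> X \<union> e"
      using Suc.prems(2)[of C X] by (auto simp: absorbs_def)
    define M' where "M' = M \<union> (R C - {e}) \<union> {f, g}"
    have U: "U \<inter> \<Union>M = {}" "U \<inter> \<Union>(R C) = {}" "\<And>i. i < C \<Longrightarrow> U \<inter> \<Union>(R i) = {}"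
      by (auto simp: U_def less_Suc_eq)
    have RC': "h \<inter> e = {}" if "h \<in> R C - {e}" for h
      using RC(1) that e(1) by (auto simp: hmatching_def pairwise_def disjnt_def)
    have new: "(X \<union> e) \<inter> \<Union>(M \<union> (R C - {e})) = {}"
      using U X(1) RC(2) e(1) RC' by blast
    have "hmatching E (M \<union> (R C - {e}))"
      using RC(2) by (intro hmatching_Un Suc.prems(4) hmatching_subset[OF RC(1)]) auto
    then have "hmatching E M'"
      using fg new unfolding M'_def hmatching_def pairwise_def disjnt_def by blast
    moreover have "\<Union>M' \<inter> \<Union>(R i) = {}" if "i < C" for i
    proof -
      have "(X \<union> e) \<inter> \<Union>(R i) = {}" using fresh[OF that] e(1) U(3)[OF that] X(1) by blast
      moreover have "\<Union>M \<inter> \<Union>(R i) = {}" using Suc.prems(5)[of i] that by simp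
      moreover have "\<Union>M' \<subseteq> \<Union>M \<union> \<Union>(R C) \<union> (X \<union> e)" using fg(4) by (auto simp: M'_def)
      ultimately show ?thesis using fresh[OF that] by blast
    qed
    moreover have "card (V - \<Union>M' - (\<Union>i<C. \<Union>(R i))) \<le> k + k * C"
    proof -
      have ke: "card h = k" "finite h" if "h \<in> E" for h using that V by (auto simp: nsets_def)
      have eE: "e \<in> E" using e(1) RC(1) by (auto simp: hmatching_def)
      \<comment> \<open>Releasing \<open>e\<close> adds \<open>k\<close> vertices to
        \<open>U\<close>, and \<open>f\<close> and \<open>g\<close> take \<open>2 * k\<close> away:
        a net loss of \<open>k\<close>.\<close>
      have "V - \<Union>M' - (\<Union>i<C. \<Union>(R i)) \<subseteq> (U \<union> e) - (f \<union> g)"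
        by (auto simp: M'_def U_def less_Suc_eq)
      then have "card (V - \<Union>M' - (\<Union>i<C. \<Union>(R i))) \<le> card ((U \<union> e) - (f \<union> g))"
        using finU ke eE by (intro card_mono) auto
      also have "\<dots> = card (U \<union> e) - card (f \<union> g)"
        using fg X ke by (intro card_Diff_subset) auto
      also have "card (U \<union> e) = card U + k"
        using U(2) e(1) eE ke finU by (subst card_Un_disjoint) auto
      also have "card (f \<union> g) = 2 * k"
        using fg ke by (simp add: card_Un_disjoint)
      finally show ?thesis using Suc.prems(6) by (simp add: U_def)
    qed
    ultimately show ?thesis by (rule step)
  qed
qed

section \<open>Almost perfect matchings from a maximum matching\<close>

lemma ex_disjoint_subsets:
  assumes "finite U" "m * r \<le> card U"
  shows "\<exists>S. (\<forall>i<m. S i \<subseteq> U \<and> card (S i) = r) \<and> (\<forall>i<m. \<forall>j<m. i \<noteq> j \<longrightarrow> S i \<inter> S j = {})"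
  using assms(2)
proof (induction m)
  case 0
  show ?case by simp
next
  case (Suc m)
  then obtain S where S: "\<forall>i<m. S i \<subseteq> U \<and> card (S i) = r" "\<forall>i<m. \<forall>j<m. i \<noteq> j \<longrightarrow> S i \<inter> S j = {}"
    by auto
  have "card (\<Union>i<m. S i) \<le> (\<Sum>i<m. card (S i))" by (rule card_UN_le) simp
  also have "\<dots> = m * r" using S by simp
  finally have "r \<le> card U - card (\<Union>i<m. S i)" using Suc.prems by simp
  also have "\<dots> = card (U - (\<Union>i<m. S i))"
    using S assms(1) by (intro card_Diff_subset[symmetric]) (auto intro: finite_subset)
  finally obtain T where "T \<subseteq> U - (\<Union>i<m. S i)" "card T = r"
    by (meson obtain_subset_with_card_n)
  moreover from this have "\<forall>i<m. S i \<inter> T = {} \<and> T \<inter> S i = {}" by blast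
  ultimately show ?case
    using S by (intro exI[of _ "S(m := T)"]) (auto simp: less_Suc_eq)
qed

text \<open>A greedy choice replaces Hall's theorem: the representatives already chosen are too few
  to exhaust \<open>J x\<close>.\<close>

lemma ex_distinct_representatives:
  assumes "finite K" "\<And>x. x \<in> K \<Longrightarrow> card K \<le> card (J x)"
  shows "\<exists>s. inj_on s K \<and> (\<forall>x\<in>K. s x \<in> J x)"
  using assms
proof (induction K)
  case empty
  show ?case by simp
next
  case (insert x K)
  have "card K \<le> card (J y)" if "y \<in> K" for y
    using insert.prems[of y] insert.hyps that by simp
  then obtain s where s: "inj_on s K" "\<forall>y\<in>K. s y \<in> J y"
    using insert.IH by blast
  have "card (s ` K) < card (J x)"
    using insert.prems[of x] insert.hyps card_image_le[of K s] by simp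
  then have "\<not> J x \<subseteq> s ` K" using insert.hyps by (meson card_mono finite_imageI leD)
  then obtain i where i: "i \<in> J x" "i \<notin> s ` K" by blast
  have eq: "(s(x := i)) ` K = s ` K" using insert.hyps by (auto simp: fun_upd_def image_iff)
  have "inj_on (s(x := i)) (insert x K)"
    unfolding inj_on_insert using inj_on_fun_updI[OF s(1) i(2), of x] insert.hyps(2) i(2) eq by simp
  then show ?case
    using s(2) i(1) by (intro exI[of _ "s(x := i)"] conjI) (simp_all add: fun_upd_def)
qed

text \<open>\<open>{} \<notin> E\<close> guards against a shared empty edge, which disjointness of
  the vertex sets does not exclude.\<close>

lemma card_hmatching_Un:
  assumes "hmatching E M" "hmatching E N" "\<Union>M \<inter> \<Union>N = {}" "{} \<notin> E" "finite M" "finite N"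
  shows "card (M \<union> N) = card M + card N"
proof (rule card_Un_disjoint)
  have "M \<inter> N \<subseteq> {{}}" using assms(3) by blast
  moreover have "{} \<notin> M" using assms(1,4) by (auto simp: hmatching_def)
  ultimately show "M \<inter> N = {}" by blast
qed (use assms in auto)

text \<open>If a maximum matching left more uncovered, an exchange would remove \<open>k\<close>
  edges and insert \<open>k + 1\<close>. \<open>n\<close> only bounds \<open>card V\<close>, because
  the lemma is applied after the reserve has been deleted, with thresholds still measured against
  the original order.\<close>

lemma ex_almost_perfect_matching:
  fixes \<delta> :: real and k m n :: nat
  assumes V: "finite V" "E \<subseteq> nsets V k" "card V \<le> n" and k: "k \<ge> 2" and m: "2 * k \<le> \<delta> * m"
    and deg: "\<And>S. S \<in> nsets V (k - 1) \<Longrightarrow> \<delta> * n \<le> card (nbrs V E S)"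
    and indep: "\<And>W. W \<subseteq> V \<Longrightarrow> \<delta> / (2 * real k) * n \<le> card W \<Longrightarrow> \<exists>e\<in>E. e \<subseteq> W"
  shows "\<exists>M. hmatching E M \<and> card (V - \<Union>M) \<le> m * (k - 1)"
proof -
  have finE: "finite E" using V finite_imp_finite_nsets finite_subset by blast
  have edge: "card e = k" "finite e" "e \<subseteq> V" "e \<noteq> {}" if "e \<in> E" for e
    using that V k by (auto simp: nsets_def)
  then have empty: "{} \<notin> E" by blast
  have "hmatching E {}" by (simp add: hmatching_def)
  moreover have "\<forall>M'. hmatching E M' \<longrightarrow> card M' < Suc (card E)"
    using card_mono[OF finE] by (simp add: hmatching_def less_Suc_eq_le)
  ultimately have "\<exists>M. hmatching E M \<and> (\<forall>M'. hmatching E M' \<longrightarrow> card M' \<le> card M)"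
    by (rule ex_has_greatest_nat)
  then obtain M where M: "hmatching E M" and max: "\<And>M'. hmatching E M' \<Longrightarrow> card M' \<le> card M"
    by blast
  note cM = card_Union_hmatching[OF V(1,2) M]
  define U where "U = V - \<Union>M"
  have finU: "finite U" using V by (simp add: U_def)
  show ?thesis
  proof (rule ccontr)
    assume "\<not> ?thesis"
    then have "m * (k - 1) \<le> card U" using M U_def by (meson linear)
    from ex_disjoint_subsets[OF finU this] obtain S
      where "(\<forall>i<m. S i \<subseteq> U \<and> card (S i) = k - 1) \<and> (\<forall>i<m. \<forall>j<m. i \<noteq> j \<longrightarrow> S i \<inter> S j = {})" ..
    then have S: "\<And>i. i < m \<Longrightarrow> S i \<subseteq> U" "\<And>i. i < m \<Longrightarrow> card (S i) = k - 1"
      "\<And>i j. i < m \<Longrightarrow> j < m \<Longrightarrow> i \<noteq> j \<Longrightarrow> S i \<inter> S j = {}" by simp_all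
    have SV: "S i \<in> nsets V (k - 1)" if "i < m" for i
      using S(1,2)[OF that] finU by (auto simp: nsets_def U_def intro: finite_subset)
    define N where "N i = nbrs V E (S i)" for i
    \<comment> \<open>A neighbour of \<open>S i\<close> inside \<open>U\<close> would give an edge
      inside \<open>U\<close>, enlarging \<open>M\<close>.\<close>
    have NU: "N i \<inter> U = {}" if i: "i < m" for i
    proof (rule ccontr)
      assume "N i \<inter> U \<noteq> {}"
      then obtain v where v: "v \<in> U" "insert v (S i) \<in> E" by (auto simp: N_def nbrs_def)
      have 1: "hmatching E {insert v (S i)}" using v by (simp add: hmatching_def)
      have 2: "\<Union>M \<inter> \<Union>{insert v (S i)} = {}" using v S(1)[OF i] by (auto simp: U_def)
      show False
        using max[OF hmatching_Un[OF M 1 2]] card_hmatching_Un[OF M 1 2 empty cM(2)] by simp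
    qed
    define I where "I v = {i \<in> {..<m}. v \<in> N i}" for v
    \<comment> \<open>The threshold \<open>k\<close> later allows \<open>k\<close> chosen vertices
      of \<open>W\<close> to receive distinct sets \<open>S i\<close>.\<close>
    define W where "W = {v \<in> V. k \<le> card (I v)}"
    have VW: "V \<inter> W = W" by (auto simp: W_def)
    have cI: "card (I v) \<le> m" for v
      using card_mono[of "{..<m}" "I v"] by (auto simp: I_def)
    have NV: "N i = {v \<in> V. v \<in> N i}" for i by (auto simp: N_def nbrs_def)
    \<comment> \<open>Double counting of the pairs with \<open>v \<in> N i\<close>. Vertices outside
      \<open>W\<close> contribute at most \<open>k * n\<close>, which is at most half of the lower
      bound \<open>m * (\<delta> * n)\<close>; so \<open>W\<close> has at least
      \<open>\<delta> * n / 2\<close> elements.\<close>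
    have "(\<Sum>i<m. card (N i)) = (\<Sum>i<m. card {v \<in> V. v \<in> N i})" using NV by simp
    also have "\<dots> = (\<Sum>v\<in>V. card (I v))"
      using sum.swap_restrict[OF finite_lessThan[of m] V(1), of "\<lambda>_ _. 1::nat" "\<lambda>i v. v \<in> N i"]
      by (simp add: I_def)
    also have "\<dots> \<le> (\<Sum>v\<in>V. k + (if v \<in> W then m else 0))"
      using cI by (intro sum_mono) (auto simp: W_def trans_le_add2)
    also have "\<dots> = k * card V + m * card W"
      using V(1) VW by (simp add: sum.distrib sum.If_cases mult.commute)
    also have "\<dots> \<le> k * n + m * card W" using V(3) by simp
    finally have "real (\<Sum>i<m. card (N i)) \<le> k * n + m * card W" by linarith
    moreover have "m * (\<delta> * n) \<le> real (\<Sum>i<m. card (N i))"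
      using deg[OF SV] sum_bounded_below[of "{..<m}" "\<delta> * n" "\<lambda>i. real (card (N i))"]
      by (simp add: N_def)
    moreover have "2 * (k * n) \<le> m * (\<delta> * n)"
      using mult_right_mono[OF m, of "real n"] by (simp add: mult_ac)
    ultimately have "m * (\<delta> * n) \<le> m * (2 * real (card W))" by simp
    moreover have "m > 0" using m k by (cases m) auto
    ultimately have cW: "\<delta> * n \<le> 2 * card W" by simp
    have WM: "W \<subseteq> \<Union>M"
    proof
      fix v assume v: "v \<in> W"
      then have "I v \<noteq> {}" using k by (auto simp: W_def)
      then obtain i where "i < m" "v \<in> N i" by (auto simp: I_def)
      then show "v \<in> \<Union>M" using NU v by (auto simp: U_def W_def)
    qed
    define MW where "MW = {e \<in> M. e \<inter> W \<noteq> {}}"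
    have MW: "MW \<subseteq> M" "finite MW" using cM by (auto simp: MW_def)
    \<comment> \<open>A matching edge holds at most \<open>k\<close> vertices of \<open>W\<close>;
      this gives the factor \<open>2 * k\<close> in the independence threshold.\<close>
    have "W \<subseteq> \<Union>MW" using WM by (auto simp: MW_def)
    then have "card W \<le> card (\<Union>MW)"
      using card_Union_hmatching(3)[OF V(1,2) hmatching_subset[OF M MW(1)]] V(1)
      by (intro card_mono) (auto intro: finite_subset)
    also have "\<dots> = k * card MW"
      using card_Union_hmatching(1)[OF V(1,2) hmatching_subset[OF M MW(1)]] .
    finally have "real (card W) \<le> real (k * card MW)" by (simp only: of_nat_le_iff)
    then have "\<delta> * n \<le> card MW * (2 * real k)" using cW by (simp add: algebra_simps)
    then have cMW: "\<delta> / (2 * real k) * n \<le> card MW"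
      using k by (simp add: pos_divide_le_eq)
    have ME: "M \<subseteq> E" using M by (simp add: hmatching_def)
    have "\<forall>e\<in>MW. \<exists>w. w \<in> e \<inter> W" by (auto simp: MW_def)
    from bchoice[OF this] obtain w where "\<forall>e\<in>MW. w e \<in> e \<inter> W" ..
    then have w: "\<And>e. e \<in> MW \<Longrightarrow> w e \<in> e" "\<And>e. e \<in> MW \<Longrightarrow> w e \<in> W" by simp_all
    \<comment> \<open>An edge made of second vertices \<open>u\<close> leaves the vertices
      \<open>w\<close> free for the other new edges.\<close>
    have "\<forall>e\<in>MW. \<exists>u. u \<in> e - {w e}"
    proof
      fix e assume that: "e \<in> MW"
      have "card e = k" using that MW ME edge by blast
      then have "\<not> e \<subseteq> {w e}" using k card_mono[of "{w e}" e] by auto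
      then show "\<exists>u. u \<in> e - {w e}" by blast
    qed
    from bchoice[OF this] obtain u where "\<forall>e\<in>MW. u e \<in> e - {w e}" ..
    then have u: "\<And>e. e \<in> MW \<Longrightarrow> u e \<in> e" "\<And>e. e \<in> MW \<Longrightarrow> u e \<noteq> w e" by simp_all
    have same: "e = e'" if "e \<in> MW" "e' \<in> MW" "v \<in> e" "v \<in> e'" for e e' v
      using pairwiseD[of disjnt M e e'] M MW(1) that by (auto simp: hmatching_def disjnt_iff)
    have inj: "inj_on u MW"
    proof (rule inj_onI)
      fix e e' assume "e \<in> MW" "e' \<in> MW" "u e = u e'"
      then show "e = e'" using same[of e e' "u e"] u(1)[of e] u(1)[of e'] by simp
    qed
    have "u ` MW \<subseteq> V" using u(1) MW ME edge by blast
    moreover have "\<delta> / (2 * real k) * n \<le> card (u ` MW)" using cMW card_image[OF inj] by simp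
    ultimately obtain f where f: "f \<in> E" "f \<subseteq> u ` MW" using indep[of "u ` MW"] by auto
    define K where "K = {e \<in> MW. u e \<in> f}"
    have K: "K \<subseteq> MW" "u ` K = f" "finite K" using f MW by (auto simp: K_def)
    have KMW: "e \<in> MW" "e \<in> M" if "e \<in> K" for e using K(1) MW(1) that by auto
    have cK: "card K = k" using card_image[OF inj_on_subset[OF inj K(1)]] K(2) edge(1)[OF f(1)] by simp
    have "card K \<le> card (I (w e))" if "e \<in> K" for e
      using w(2) K(1) that cK by (auto simp: W_def)
    from ex_distinct_representatives[OF K(3) this] obtain s
      where "inj_on s K \<and> (\<forall>e\<in>K. s e \<in> I (w e))" ..
    then have s: "inj_on s K" "\<And>e. e \<in> K \<Longrightarrow> s e \<in> I (w e)" by simp_all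
    have sm: "s e < m" "w e \<in> N (s e)" if "e \<in> K" for e using s(2)[OF that] by (auto simp: I_def)
    define g where "g e = insert (w e) (S (s e))" for e
    have gE: "g e \<in> E" if "e \<in> K" for e using sm[OF that] by (auto simp: N_def nbrs_def g_def)
    have wU: "w e \<notin> U" if "e \<in> K" for e using w(1) K(1) MW(1) that by (auto simp: U_def)
    have SU: "S (s e) \<subseteq> U" if "e \<in> K" for e using S(1) sm that by blast
    have gg: "g e \<inter> g e' = {}" if "e \<in> K" "e' \<in> K" "e \<noteq> e'" for e e'
    proof -
      have "w e \<noteq> w e'" using same[of e e' "w e"] w(1)[of e] w(1)[of e'] KMW that by auto
      moreover have "S (s e) \<inter> S (s e') = {}"
        using S(3)[of "s e" "s e'"] sm that inj_onD[OF s(1), of e e'] by blast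
      moreover have "w e \<notin> U" "w e' \<notin> U" "S (s e) \<subseteq> U" "S (s e') \<subseteq> U"
        using wU SU that by auto
      ultimately show ?thesis unfolding g_def by blast
    qed
    have fM: "f \<subseteq> \<Union>K" using u(1) K by blast
    have fg: "f \<inter> g e = {}" if "e \<in> K" for e
    proof -
      \<comment> \<open>\<open>w e = u e'\<close> would force \<open>e = e'\<close> by disjointness
        of matching edges, but \<open>u e\<close> differs from \<open>w e\<close>.\<close>
      have "w e \<notin> f"
      proof
        assume "w e \<in> f"
        then obtain e' where "e' \<in> K" "w e = u e'" using K(2) by blast
        then show False using same[of e e' "w e"] u[of e'] w(1)[of e] u(2)[of e] KMW that by auto
      qed
      moreover have "f \<inter> U = {}" using fM K(1) MW(1) by (auto simp: U_def)
      ultimately show ?thesis using SU[OF that] by (auto simp: g_def)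
    qed
    have inj_g: "inj_on g K"
    proof (rule inj_onI)
      fix e e' assume "e \<in> K" "e' \<in> K" "g e = g e'"
      then show "e = e'" using gg[of e e'] by (auto simp: g_def)
    qed
    have hg: "hmatching E (g ` K)"
      using gE gg by (auto simp: hmatching_def pairwise_def disjnt_def)
    have hf: "hmatching E {f}" using f(1) by (simp add: hmatching_def)
    have fgK: "\<Union>{f} \<inter> \<Union>(g ` K) = {}" using fg by auto
    have new: "hmatching E ({f} \<union> g ` K)" "card ({f} \<union> g ` K) = k + 1"
      using hmatching_Un[OF hf hg fgK] card_hmatching_Un[OF hf hg fgK empty] K(3)
        card_image[OF inj_g] cK by auto
    have hMK: "hmatching E (M - K)" by (rule hmatching_subset[OF M]) auto
    have "e \<inter> e' = {}" if "e \<in> K" "e' \<in> M - K" for e e'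
      using pairwiseD[of disjnt M e e'] M KMW(2)[of e] that by (auto simp: hmatching_def disjnt_def)
    then have K0: "\<Union>K \<inter> \<Union>(M - K) = {}" by blast
    have "g e \<inter> \<Union>(M - K) = {}" if "e \<in> K" for e
    proof -
      have "w e \<in> \<Union>K" using w(1)[OF KMW(1)[OF that]] that by blast
      moreover have "S (s e) \<inter> \<Union>M = {}" using SU[OF that] by (auto simp: U_def)
      ultimately show ?thesis using K0 unfolding g_def by blast
    qed
    then have disj: "\<Union>(M - K) \<inter> \<Union>({f} \<union> g ` K) = {}"
      using K0 fM by blast
    have "card ((M - K) \<union> ({f} \<union> g ` K)) = card (M - K) + (k + 1)"
      using card_hmatching_Un[OF hMK new(1) disj empty] cM(2) K(3) new(2) by simp
    moreover have "card (M - K) = card M - k" "k \<le> card M"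
      using K(1,3) MW(1) cM(2) cK card_mono[of M K] by (auto simp: card_Diff_subset)
    ultimately show False using max[OF hmatching_Un[OF hMK new(1) disj]] by simp
  qed
qed

section \<open>Choice of constants and conclusion\<close>

text \<open>Exponential decay beats the polynomial. The bound \<open>q \<le> exp (q - 1)\<close>
  treats \<open>q = 0\<close> along with the rest.\<close>

lemma eventually_power_floor_times_power_less_one:
  fixes q c :: real
  assumes "0 \<le> q" "q < 1" "c > 0"
  shows "\<forall>\<^sub>F n :: nat in sequentially. q ^ nat \<lfloor>c * n\<rfloor> * real n ^ K < 1"
proof -
  define b where "b = 1 - q"
  have b: "b > 0" using assms by (simp add: b_def)
  have lim: "filterlim (\<lambda>n. b * c * real n) at_top sequentially"
    using b assms by (intro filterlim_tendsto_pos_mult_at_top[OF tendsto_const] filterlim_real_sequentially) auto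
  have "((\<lambda>n. (b * c * real n) ^ K / exp (b * c * real n)) \<longlongrightarrow> 0) sequentially"
    by (rule filterlim_compose[OF tendsto_power_div_exp_0 lim])
  \<comment> \<open>The threshold cancels the scaling \<open>(b * c) ^ K\<close> and the factor
    \<open>exp b\<close> lost by rounding the exponent down.\<close>
  then have "\<forall>\<^sub>F n in sequentially. (b * c * real n) ^ K / exp (b * c * real n) < (b * c) ^ K / exp b"
    using b assms by (intro order_tendstoD) auto
  then show ?thesis
  proof eventually_elim
    case (elim n)
    define t where "t = nat \<lfloor>c * n\<rfloor>"
    have t: "c * n - 1 \<le> t" using assms unfolding t_def by linarith
    have "q \<le> exp (- b)" using exp_ge_add_one_self[of "- b"] by (simp add: b_def)
    then have "q ^ t \<le> exp (- b) ^ t" using assms by (intro power_mono)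
    also have "\<dots> = exp (- (b * t))" by (simp add: exp_of_nat_mult[symmetric] mult.commute)
    also have "\<dots> \<le> exp (b - b * c * n)"
      using mult_left_mono[OF t, of b] b by (simp add: algebra_simps)
    finally have "q ^ t * real n ^ K \<le> exp (b - b * c * n) * real n ^ K"
      by (rule mult_right_mono) simp
    also have "\<dots> < 1"
      using elim b assms by (simp add: exp_diff power_mult_distrib field_simps)
    finally show ?case by (simp add: t_def)
  qed
qed

theorem theorem1p1:
  fixes k :: nat and \<gamma> :: real
  assumes "k \<ge> 3" and "\<gamma> > 0"
  shows "\<exists>\<epsilon>::real. \<epsilon> > 0 \<and> (\<forall>\<^sub>F n :: nat in sequentially.
    \<forall>(V :: 'a set) (E :: 'a set set).
      kgraph k V E \<longrightarrow> card V = n \<longrightarrow>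
      real (independence_number V E) \<le> \<epsilon> * real n \<longrightarrow>
      real (min_codegree k V E) \<ge> \<gamma> * real n \<longrightarrow>
      (\<exists>M. hmatching E M \<and> card (V - \<Union>M) \<le> k))"
proof -
  \<comment> \<open>Capping at \<open>1\<close> keeps the absorbed fraction \<open>\<beta>\<close>
    at most \<open>1\<close>.\<close>
  define \<gamma>' where "\<gamma>' = min \<gamma> 1"
  have \<gamma>': "0 < \<gamma>'" "\<gamma>' \<le> 1" "\<gamma>' \<le> \<gamma>" using assms by (auto simp: \<gamma>'_def)
  have k: "k \<ge> 3" "k \<ge> 2" "k > 0" using assms by auto
  \<comment> \<open>The reserve will take at most \<open>\<gamma>' / 8 * n\<close> vertices, so
    codegree \<open>\<delta> * n\<close> survives outside it.\<close>
  define \<delta> where "\<delta> = \<gamma>' / 2"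
  \<comment> \<open>\<open>m\<close> serves twice: it bounds the leftover by
    \<open>m * (k - 1)\<close>, and it is the number of reserved matchings.\<close>
  define m where "m = nat \<lceil>2 * k / \<delta>\<rceil>"
  \<comment> \<open>Half of the fraction in \<open>ex_almost_perfect_matching\<close>, so that sets
    of that size strictly exceed the independence number.\<close>
  define \<epsilon> where "\<epsilon> = \<delta> / (4 * real k)"
  have \<delta>: "\<delta> > 0" and \<epsilon>: "\<epsilon> > 0" "\<epsilon> < \<delta> / (2 * real k)"
    using \<gamma>' k by (auto simp: \<delta>_def \<epsilon>_def field_simps)
  have "2 * k / \<delta> \<le> m" unfolding m_def by linarith
  then have m: "2 * k \<le> \<delta> * m" using \<delta> by (simp add: field_simps)
  define \<beta> where "\<beta> = (\<gamma>' / (2 * real k)) ^ k"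
  have \<beta>: "0 < \<beta>" "\<beta> \<le> 1"
    using \<gamma>' k by (auto simp: \<beta>_def divide_le_eq intro!: power_le_one)
  \<comment> \<open>With this \<open>c\<close>, \<open>m\<close> matchings of at most
    \<open>c * n\<close> edges occupy at most \<open>\<gamma>' / 8 * n\<close> vertices.\<close>
  define c where "c = \<gamma>' / (8 * real k * (real m + 1))"
  have c: "c > 0" using \<gamma>' k by (simp add: c_def)
  have large: "\<forall>\<^sub>F n in sequentially. 2 * real k + 1 \<le> \<gamma>' / 8 * real n"
  proof -
    have "filterlim (\<lambda>n. \<gamma>' / 8 * real n) at_top sequentially"
      using \<gamma>' by (intro filterlim_tendsto_pos_mult_at_top[OF tendsto_const] filterlim_real_sequentially) auto
    then show ?thesis unfolding filterlim_at_top by (rule spec)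
  qed
  \<comment> \<open>The size of each reserve is still linear in \<open>n\<close>, so geometric decay
    outweighs the number of \<open>(k + 1)\<close>-sets.\<close>
  have decay: "\<forall>\<^sub>F n in sequentially. (1 - \<beta>) ^ nat \<lfloor>c * n\<rfloor> * real n ^ (k + 1) < 1"
    using \<beta> c by (intro eventually_power_floor_times_power_less_one) auto
  have "\<forall>\<^sub>F n in sequentially. \<forall>(V :: 'a set) (E :: 'a set set).
      kgraph k V E \<longrightarrow> card V = n \<longrightarrow>
      real (independence_number V E) \<le> \<epsilon> * real n \<longrightarrow>
      real (min_codegree k V E) \<ge> \<gamma> * real n \<longrightarrow>
      (\<exists>M. hmatching E M \<and> card (V - \<Union>M) \<le> k)"
    using large decay eventually_gt_at_top[of 0]
  proof eventually_elim
    case (elim n)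
    show ?case
    proof (intro allI impI)
      fix V :: "'a set" and E :: "'a set set"
      assume "kgraph k V E" and n: "card V = n"
        and indep: "real (independence_number V E) \<le> \<epsilon> * real n"
        and codeg: "\<gamma> * real n \<le> real (min_codegree k V E)"
      then have V: "finite V" "E \<subseteq> nsets V k" by (auto simp: kgraph_def)
      have deg: "\<gamma>' * n \<le> card (nbrs V E S)" if "S \<in> nsets V (k - 1)" for S
      proof -
        have "\<gamma>' * n \<le> \<gamma> * n" using \<gamma>' by (intro mult_right_mono) auto
        also note codeg
        also have "real (min_codegree k V E) \<le> card (nbrs V E S)"
          using min_codegree_le_nbrs[OF V(1) that] by simp
        finally show ?thesis .
      qed
      define t where "t = nat \<lfloor>c * n\<rfloor>"
      have "real t \<le> c * n" using c by (simp add: t_def)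
      then have "real (k * t * m) \<le> real k * (c * n) * real m"
        unfolding of_nat_mult by (intro mult_right_mono mult_left_mono) auto
      also have "\<dots> = \<gamma>' / 8 * n * (real m / (real m + 1))"
        using k by (simp add: c_def)
      also have "\<dots> \<le> \<gamma>' / 8 * n * 1"
        using \<gamma>' by (intro mult_left_mono) auto
      finally have ktm: "real (k * t * m) \<le> \<gamma>' / 8 * n" by simp
      then have small: "real (k * t * m + 2 * k + 1) \<le> \<gamma>' / 2 * card V"
        using elim(1) n by simp
      have "(1 - \<beta>) ^ t * card V ^ (k + 1) < 1" using elim(2) n by (simp add: t_def)
      from ex_absorbing_matchings[OF V(1) _ V(2) k(1) \<gamma>'(1,2) _ small this[unfolded \<beta>_def]] deg n elim(3)
      obtain R where "\<forall>i<m. hmatching E (R i) \<and> card (R i) \<le> t \<and>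
          (\<forall>X\<in>nsets V (k + 1). \<exists>e\<in>R i. absorbs E X e) \<and> (\<forall>j<i. \<Union>(R i) \<inter> \<Union>(R j) = {})"
        by auto
      then have R: "\<And>i. i < m \<Longrightarrow> hmatching E (R i)" "\<And>i. i < m \<Longrightarrow> card (R i) \<le> t"
        "\<And>i X. i < m \<Longrightarrow> X \<in> nsets V (k + 1) \<Longrightarrow> \<exists>e\<in>R i. absorbs E X e"
        "\<And>i j. j < i \<Longrightarrow> i < m \<Longrightarrow> \<Union>(R i) \<inter> \<Union>(R j) = {}"
        by simp_all
      define Q where "Q = (\<Union>i<m. \<Union>(R i))"
      have "card Q \<le> (\<Sum>i<m. card (\<Union>(R i)))" unfolding Q_def by (rule card_UN_le) simp
      also have "\<dots> \<le> (\<Sum>i<m. k * t)"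
        using card_Union_hmatching(1)[OF V R(1)] R(2) by (intro sum_mono) simp
      also have "\<dots> = k * t * m" by simp
      finally have "real (card Q) \<le> real (k * t * m)" by (simp only: of_nat_le_iff)
      then have cQ: "real (card Q) \<le> \<gamma>' / 8 * n" using ktm by linarith
      have "\<Union>(R i) \<subseteq> V" if "i < m" for i using card_Union_hmatching(3)[OF V R(1)[OF that]] .
      then have QV: "Q \<subseteq> V" unfolding Q_def by blast
      \<comment> \<open>A matching inside \<open>V - Q\<close> avoids every reserve, and edges found
        inside subsets of \<open>V - Q\<close> stay in \<open>E'\<close>.\<close>
      define E' where "E' = {e \<in> E. e \<subseteq> V - Q}"
      have V': "finite (V - Q)" "E' \<subseteq> nsets (V - Q) k" "card (V - Q) \<le> n"
        using V n by (auto simp: E'_def nsets_def intro: card_mono)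
      have deg': "\<delta> * n \<le> card (nbrs (V - Q) E' S)" if S: "S \<in> nsets (V - Q) (k - 1)" for S
      proof -
        have "S \<in> nsets V (k - 1)" "S \<subseteq> V - Q" using S by (auto simp: nsets_def)
        then have "\<gamma>' * n \<le> card (nbrs V E S)" "nbrs V E S \<subseteq> nbrs (V - Q) E' S \<union> Q"
          using deg by (auto simp: nbrs_def E'_def)
        moreover have "finite (nbrs (V - Q) E' S \<union> Q)"
          using V(1) QV by (auto simp: nbrs_def intro: finite_subset)
        ultimately have "\<gamma>' * n \<le> card (nbrs (V - Q) E' S \<union> Q)"
          by (meson card_mono of_nat_le_iff order_trans)
        also have "\<dots> \<le> real (card (nbrs (V - Q) E' S) + card Q)"
          by (simp only: of_nat_le_iff card_Un_le)
        finally show ?thesis using cQ \<gamma>' by (simp add: \<delta>_def)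
      qed
      have indep': "\<exists>e\<in>E'. e \<subseteq> W" if W: "W \<subseteq> V - Q" "\<delta> / (2 * real k) * n \<le> card W" for W
      proof -
        have "\<epsilon> * n < \<delta> / (2 * real k) * n" using \<epsilon> elim(3) by (intro mult_strict_right_mono) auto
        then have "independence_number V E < card W" using indep W(2) by linarith
        then obtain e where "e \<in> E" "e \<subseteq> W" using ex_edge_of_independence_number[OF V(1), of W E] W(1) by auto
        then show ?thesis using W(1) by (auto simp: E'_def)
      qed
      obtain M where M: "hmatching E' M" "card (V - Q - \<Union>M) \<le> m * (k - 1)"
        using ex_almost_perfect_matching[OF V' k(2) m deg' indep'] by auto
      have ME: "hmatching E M" using M(1) by (auto simp: hmatching_def E'_def)
      have "\<Union>M \<inter> Q = {}" using M(1) by (auto simp: hmatching_def E'_def)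
      then have disj: "\<Union>M \<inter> \<Union>(R i) = {}" if "i < m" for i using that unfolding Q_def by blast
      have "V - \<Union>M - Q = V - Q - \<Union>M" by blast
      moreover have "m * (k - 1) \<le> k + k * m" by (simp add: algebra_simps diff_mult_distrib2)
      ultimately have rest: "card (V - \<Union>M - (\<Union>i<m. \<Union>(R i))) \<le> k + k * m"
        using M(2) unfolding Q_def by simp
      show "\<exists>M. hmatching E M \<and> card (V - \<Union>M) \<le> k"
        by (rule ex_matching_of_absorbing_matchings[where C = m and R = R and M = M])
          (fact V k(3) R(1) R(3) R(4) ME disj rest)+
    qed
  qed
  with \<epsilon>(1) show ?thesis by blast
qed

end
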